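(* Let $\beta,\lambda\in\mathbb{C}$. The polynomials $s^{(+)}_m(y)$ defined in the context satisfy, for every integer $m\ge 1$, $$s^{(+)}_m(y)=\big[y+2(m-1)(\lambda+m-1)+\tfrac{\beta}{2}(\lambda-\tfrac{\beta}{2}+1)\big]s^{(+)}_{m-1}(y)-(m-1)(\lambda+m-2)(\lambda-\tfrac{\beta}{2}+m-1)(\tfrac{\beta}{2}+m-2)\,s^{(+)}_{m-2}(y),$$ with $s^{(+)}_0(y)=1$ and the convention $s^{(+)}_{-1}(y):=0$.
   Context: For $k\in\mathbb{N}_0$ put $R_k(y;0):=\prod_{l=1}^k\big[y-l(l-1)\big]$ (so $R_0(y;0)=1$). The Pochhammer symbol is $(a)_0=1$, $(a)_m=a(a+1)\cdots(a+m-1)$ for $m\ge 1$. For $m\in\mathbb{N}_0$ define $$s^{(+)}_m(y):=\sum_{k=0}^{m}\binom{m}{k}(\tfrac{\beta}{2}-\lambda-m)_{m-k}(-\tfrac{\beta}{2}-m+1)_{m-k}\,R_k(y;0).$$ *)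

theory Defs
  imports Complex_Main "HOL-Computational_Algebra.Polynomial"
begin

definition R0 :: "nat \<Rightarrow> complex poly" where
  "R0 k = (\<Prod>l=1..k. [:- (of_nat l * (of_nat l - 1)), 1:])"

definition s_plus :: "complex \<Rightarrow> complex \<Rightarrow> nat \<Rightarrow> complex poly" where
  "s_plus \<beta> lam m =
     (\<Sum>k=0..m. smult (of_nat (m choose k)
        * pochhammer (\<beta> / 2 - lam - of_nat m) (m - k)
        * pochhammer (- \<beta> / 2 - of_nat m + 1) (m - k)) (R0 k))"

(* Extension to integer indices, encoding the convention that the polynomial of index -1 is zero. *)
definition s_plus_int :: "complex \<Rightarrow> complex \<Rightarrow> int \<Rightarrow> complex poly" where
  "s_plus_int \<beta> lam j = (if j < 0 then 0 else s_plus \<beta> lam (nat j))"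

end

theory Submission
  imports Defs
begin

text \<open>
  Write \<open>A = \<beta>/2 - \<lambda>\<close> and \<open>B = 1 - \<beta>/2\<close>. The coefficient of \<open>R\<^sub>k\<close> in the \<open>m\<close>-th polynomial is
  \<open>c\<^sub>m\<^sub>,\<^sub>k = binomial(m,k) * w\<^sub>k\<^sub>+\<^sub>1 \<cdots> w\<^sub>m\<close> with \<open>w\<^sub>j = (A - j)(B - j)\<close>: both Pochhammer symbols are products
  over \<open>j = k+1, \<dots>, m\<close>. The recurrence, rewritten in \<open>A\<close> and \<open>B\<close>, is symmetric in the two.

  Since \<open>y R\<^sub>k = R\<^sub>k\<^sub>+\<^sub>1 + k(k+1) R\<^sub>k\<close>, multiplication by \<open>y\<close> acts on coefficients as a shift plus a
  diagonal term (lemma \<open>X_mult_R0\<close>), so that it is enough to compare the coefficients of each \<open>R\<^sub>k\<close>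
  (lemma \<open>coeff_recurrence\<close>). All terms of that identity share the factor \<open>w\<^sub>k\<^sub>+\<^sub>1 \<cdots> w\<^sub>m\<close>. Once it is
  taken out, Pascal's rule and the two absorption identities for binomial coefficients leave a
  polynomial identity, which holds because \<open>w\<^sub>i - w\<^sub>j = (i - j)(i + j - A - B)\<close>.
\<close>

definition dual_coeff :: "complex \<Rightarrow> complex \<Rightarrow> nat \<Rightarrow> nat \<Rightarrow> complex" where
  "dual_coeff A B m k = of_nat (m choose k)
     * pochhammer (A - of_nat m) (m - k) * pochhammer (B - of_nat m) (m - k)"

lemma s_plus_eq_sum_dual_coeff:
  assumes "m \<le> N"
  shows "s_plus \<beta> lam m = (\<Sum>k\<le>N. smult (dual_coeff (\<beta> / 2 - lam) (1 - \<beta> / 2) m k) (R0 k))"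
proof -
  have "s_plus \<beta> lam m = (\<Sum>k\<le>m. smult (dual_coeff (\<beta> / 2 - lam) (1 - \<beta> / 2) m k) (R0 k))"
    unfolding s_plus_def dual_coeff_def atMost_atLeast0
    by (intro sum.cong refl) (simp add: algebra_simps)
  also have "\<dots> = (\<Sum>k\<le>N. smult (dual_coeff (\<beta> / 2 - lam) (1 - \<beta> / 2) m k) (R0 k))"
    using assms by (intro sum.mono_neutral_left) (auto simp: dual_coeff_def)
  finally show ?thesis .
qed

lemma smult_sum_right: "smult a (\<Sum>i\<in>I. f i) = (\<Sum>i\<in>I. smult a (f i))"
  by (induction I rule: infinite_finite_induct) (simp_all add: smult_add_right)

lemma X_mult_R0: "[:0, 1:] * R0 k = R0 (Suc k) + smult (of_nat k * (of_nat k + 1)) (R0 k)"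
proof -
  have "R0 (Suc k) = [:- ((of_nat k + 1) * of_nat k), 1:] * R0 k"
    by (simp add: R0_def mult.commute add.commute)
  moreover have "[:- ((of_nat k + 1) * of_nat k), 1:]
      = [:0, 1:] - [:of_nat k * (of_nat k + 1) :: complex:]"
    by (simp add: mult.commute)
  ultimately show ?thesis by (simp only: left_diff_distrib) simp
qed

lemma pochhammer_lower_base:
  fixes A :: complex
  assumes "k \<le> m"
  shows "pochhammer (A - of_nat (Suc m)) (Suc m - k)
    = (A - of_nat (Suc m)) * pochhammer (A - of_nat m) (m - k)"
  using assms by (simp add: Suc_diff_le pochhammer_rec algebra_simps)

lemma pochhammer_lower_index:
  fixes A :: complex
  assumes "Suc k \<le> m"
  shows "pochhammer (A - of_nat m) (m - k)
    = (A - of_nat (Suc k)) * pochhammer (A - of_nat m) (m - Suc k)"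
proof -
  have "m - k = Suc (m - Suc k)" using assms by simp
  moreover have "A - of_nat m + of_nat (m - Suc k) = A - of_nat (Suc k)"
    using assms by (simp add: of_nat_diff)
  ultimately show ?thesis by (metis pochhammer_Suc mult.commute)
qed

lemma dual_coeff_lower_index:
  assumes "Suc k \<le> m"
  shows "dual_coeff A B m k = of_nat (m choose k) * ((A - of_nat (Suc k)) * (B - of_nat (Suc k)))
     * (pochhammer (A - of_nat m) (m - Suc k) * pochhammer (B - of_nat m) (m - Suc k))"
  unfolding dual_coeff_def pochhammer_lower_index[OF assms] by (simp add: ac_simps)

text \<open>
  Absorption: \<open>m binomial(m-1,k) = (m-k) binomial(m,k)\<close>, and \<open>w\<^sub>m\<close> is the factor by which the products
  for \<open>m\<close> and \<open>m - 1\<close> differ when \<open>k < m\<close>. For \<open>k \<ge> m\<close> both sides vanish; this covers \<open>m = 0\<close>,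
  so that the recurrence below needs no separate initial step.
\<close>
lemma dual_coeff_absorb:
  "of_nat m * ((A - of_nat m) * (B - of_nat m)) * dual_coeff A B (m - 1) k
     = (of_nat m - of_nat k) * dual_coeff A B m k"
proof (cases m)
  case 0
  then show ?thesis by (cases k) (auto simp: dual_coeff_def)
next
  case (Suc n)
  consider "k \<le> n" | "k = Suc n" | "k > Suc n" by linarith
  then show ?thesis
  proof cases
    case 1
    have "of_nat (Suc n) * of_nat (n choose k) = (of_nat (Suc n) - of_nat k :: complex) * of_nat (Suc n choose k)"
      using binomial_absorb_comp[of "Suc n" k] 1
      by (metis diff_Suc_1 le_SucI of_nat_diff of_nat_mult)
    then show ?thesis
      unfolding Suc dual_coeff_def pochhammer_lower_base[OF 1] by (simp del: of_nat_Suc)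
  qed (auto simp: Suc dual_coeff_def binomial_eq_0)
qed

text \<open>
  The recurrence read off at \<open>R\<^sub>k\<close>; its first summand on the right comes from the shift in \<open>y R\<^sub>k\<^sub>-\<^sub>1\<close>.
\<close>
lemma coeff_recurrence:
  assumes "k \<le> Suc m"
  shows "dual_coeff A B (Suc m) k =
    (case k of 0 \<Rightarrow> 0 | Suc j \<Rightarrow> dual_coeff A B m j)
    + (of_nat k * (of_nat k + 1) + 2 * of_nat m * (of_nat m + 1 - A - B) + (A - 1) * (B - 1))
        * dual_coeff A B m k
    - of_nat m * (of_nat m - A - B) * ((A - of_nat m) * (B - of_nat m)) * dual_coeff A B (m - 1) k"
proof (cases "k = Suc m")
  case True
  then show ?thesis by (simp add: dual_coeff_def binomial_eq_0)
next
  case False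
  with assms have km: "k \<le> m" by simp
  define Q where "Q = pochhammer (A - of_nat m) (m - k) * pochhammer (B - of_nat m) (m - k)"
  have up: "dual_coeff A B (Suc m) k
      = of_nat (Suc m choose k) * ((A - of_nat m - 1) * (B - of_nat m - 1)) * Q"
    unfolding dual_coeff_def pochhammer_lower_base[OF km] Q_def by (simp add: algebra_simps)
  have mid: "dual_coeff A B m k = of_nat (m choose k) * Q"
    unfolding dual_coeff_def Q_def by simp
  have "of_nat m * (of_nat m - A - B) * ((A - of_nat m) * (B - of_nat m)) * dual_coeff A B (m - 1) k
      = (of_nat m - A - B) * (of_nat m * ((A - of_nat m) * (B - of_nat m)) * dual_coeff A B (m - 1) k)"
    by (simp only: ac_simps)
  also have "\<dots> = (of_nat m - A - B) * (of_nat m - of_nat k) * (of_nat (m choose k) * Q)"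
    unfolding dual_coeff_absorb mid by (simp only: mult.assoc)
  finally have down: "of_nat m * (of_nat m - A - B) * ((A - of_nat m) * (B - of_nat m))
      * dual_coeff A B (m - 1) k = (of_nat m - A - B) * (of_nat m - of_nat k) * (of_nat (m choose k) * Q)" .
  show ?thesis
  proof (cases k)
    case 0
    then show ?thesis unfolding up mid down by (simp add: algebra_simps)
  next
    case (Suc j)
    define x y z u where "x = (of_nat (m choose j) :: complex)"
      and "y = (of_nat (m choose Suc j) :: complex)"
      and "z = (of_nat j :: complex)" and "u = (of_nat m :: complex)"
    have shift: "dual_coeff A B m j = x * ((A - z - 1) * (B - z - 1)) * Q"
      using dual_coeff_lower_index[of j m A B] km unfolding Suc Q_def x_def z_def
      by (simp add: algebra_simps)
    have "(z + 1) * y = of_nat (Suc j * (m choose Suc j))"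
      by (simp add: y_def z_def algebra_simps)
    also have "\<dots> = of_nat ((m - j) * (m choose j))"
      using binomial_absorption[of j m] binomial_absorb_comp[of m j] by metis
    also have "\<dots> = (u - z) * x"
      using km Suc by (simp add: of_nat_diff x_def z_def u_def)
    finally have absorb: "(z + 1) * y = (u - z) * x" .
    have pascal: "of_nat (Suc m choose k) = x + y"
      by (simp add: Suc x_def y_def)
    have k: "of_nat k = z + 1" and ky: "of_nat (m choose k) = y"
      by (simp_all add: Suc z_def y_def)
    \<comment> \<open>Collecting the terms with \<open>x\<close> gives \<open>w\<^sub>m\<^sub>+\<^sub>1 - w\<^sub>k = (m + 1 - k)(m + 1 + k - A - B)\<close>, those with \<open>y\<close>
      give \<open>-k (m + 1 + k - A - B)\<close>; the common factor leaves a multiple of the absorption identity.\<close>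
    have "(x + y) * ((A - u - 1) * (B - u - 1))
      = x * ((A - z - 1) * (B - z - 1))
        + ((z + 1) * (z + 2) + 2 * u * (u + 1 - A - B) + (A - 1) * (B - 1)) * y
        - (u - A - B) * (u - z - 1) * y
        + (u + z + 2 - A - B) * ((u - z) * x - (z + 1) * y)"
      by (simp add: algebra_simps)
    also have "(u - z) * x - (z + 1) * y = 0"
      by (simp only: absorb diff_self)
    finally have "(x + y) * ((A - u - 1) * (B - u - 1)) * Q
      = (x * ((A - z - 1) * (B - z - 1))
        + ((z + 1) * (z + 2) + 2 * u * (u + 1 - A - B) + (A - 1) * (B - 1)) * y
        - (u - A - B) * (u - z - 1) * y) * Q"
      by simp
    then have "(x + y) * ((A - u - 1) * (B - u - 1)) * Q
      = x * ((A - z - 1) * (B - z - 1)) * Q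
        + ((z + 1) * (z + 2) + 2 * u * (u + 1 - A - B) + (A - 1) * (B - 1)) * (y * Q)
        - (u - A - B) * (u - z - 1) * (y * Q)"
      by (simp only: distrib_right left_diff_distrib mult.assoc)
    then show ?thesis
      unfolding up mid down unfolding pascal ky k u_def[symmetric]
      by (simp add: Suc shift diff_diff_eq add.assoc)
  qed
qed

lemma s_plus_Suc:
  fixes \<beta> lam :: complex
  shows "s_plus \<beta> lam (Suc m) =
    ([:0, 1:] + [:2 * of_nat m * (lam + of_nat m) + \<beta> / 2 * (lam - \<beta> / 2 + 1):]) * s_plus \<beta> lam m
    - smult (of_nat m * (lam + of_nat m - 1) * (lam - \<beta> / 2 + of_nat m) * (\<beta> / 2 + of_nat m - 1))
        (s_plus \<beta> lam (m - 1))"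
proof -
  define A B where "A = \<beta> / 2 - lam" and "B = 1 - \<beta> / 2"
  define c where "c = dual_coeff A B"
  define D where "D = 2 * of_nat m * (of_nat m + 1 - A - B) + (A - 1) * (B - 1)"
  define E where "E = of_nat m * (of_nat m - A - B) * ((A - of_nat m) * (B - of_nat m))"
  have D: "2 * of_nat m * (lam + of_nat m) + \<beta> / 2 * (lam - \<beta> / 2 + 1) = D"
    unfolding D_def A_def B_def by (simp add: algebra_simps)
  have "of_nat m - A - B = lam + of_nat m - 1"
    "A - of_nat m = - (lam - \<beta> / 2 + of_nat m)" "B - of_nat m = - (\<beta> / 2 + of_nat m - 1)"
    unfolding A_def B_def by (simp_all add: algebra_simps)
  then have E: "of_nat m * (lam + of_nat m - 1) * (lam - \<beta> / 2 + of_nat m) * (\<beta> / 2 + of_nat m - 1) = E"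
    unfolding E_def by (simp only: minus_mult_minus mult.assoc)
  have s: "s_plus \<beta> lam n = (\<Sum>k\<le>N. smult (c n k) (R0 k))" if "n \<le> N" for n N
    using s_plus_eq_sum_dual_coeff[OF that] by (simp add: c_def A_def B_def)
  have "[:0, 1:] * s_plus \<beta> lam m = (\<Sum>k\<le>m. smult (c m k) ([:0, 1:] * R0 k))"
    unfolding s[OF order_refl] sum_distrib_left by (simp only: mult_smult_right)
  also have "\<dots> = (\<Sum>k\<le>m. smult (c m k) (R0 (Suc k)))
      + (\<Sum>k\<le>m. smult (of_nat k * (of_nat k + 1) * c m k) (R0 k))"
    unfolding X_mult_R0 by (simp only: smult_add_right smult_smult sum.distrib mult.commute)
  also have "(\<Sum>k\<le>m. smult (c m k) (R0 (Suc k)))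
      = (\<Sum>k\<le>Suc m. smult (case k of 0 \<Rightarrow> 0 | Suc j \<Rightarrow> c m j) (R0 k))"
    by (subst sum.atMost_Suc_shift) simp
  also have "(\<Sum>k\<le>m. smult (of_nat k * (of_nat k + 1) * c m k) (R0 k))
      = (\<Sum>k\<le>Suc m. smult (of_nat k * (of_nat k + 1) * c m k) (R0 k))"
    by (simp add: c_def dual_coeff_def)
  finally have X: "[:0, 1:] * s_plus \<beta> lam m
      = (\<Sum>k\<le>Suc m. smult (case k of 0 \<Rightarrow> 0 | Suc j \<Rightarrow> c m j) (R0 k))
        + (\<Sum>k\<le>Suc m. smult (of_nat k * (of_nat k + 1) * c m k) (R0 k))" .
  have "s_plus \<beta> lam (Suc m) = (\<Sum>k\<le>Suc m. smult (c (Suc m) k) (R0 k))"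
    by (simp only: s[OF order_refl])
  also have "\<dots> = (\<Sum>k\<le>Suc m. smult (case k of 0 \<Rightarrow> 0 | Suc j \<Rightarrow> c m j) (R0 k)
      + smult (of_nat k * (of_nat k + 1) * c m k) (R0 k)
      + smult D (smult (c m k) (R0 k)) - smult E (smult (c (m - 1) k) (R0 k)))"
  proof (intro sum.cong refl)
    fix k assume "k \<in> {..Suc m}"
    then have "c (Suc m) k = (case k of 0 \<Rightarrow> 0 | Suc j \<Rightarrow> c m j)
        + of_nat k * (of_nat k + 1) * c m k + D * c m k - E * c (m - 1) k"
      using coeff_recurrence[of k m A B]
      unfolding c_def D_def E_def atMost_iff by (simp only: distrib_right add.assoc)
    then show "smult (c (Suc m) k) (R0 k) = smult (case k of 0 \<Rightarrow> 0 | Suc j \<Rightarrow> c m j) (R0 k)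
      + smult (of_nat k * (of_nat k + 1) * c m k) (R0 k)
      + smult D (smult (c m k) (R0 k)) - smult E (smult (c (m - 1) k) (R0 k))"
      by (simp only: smult_add_left smult_diff_left smult_smult)
  qed
  also have "\<dots> = [:0, 1:] * s_plus \<beta> lam m + smult D (\<Sum>k\<le>Suc m. smult (c m k) (R0 k))
      - smult E (\<Sum>k\<le>Suc m. smult (c (m - 1) k) (R0 k))"
    unfolding X by (simp only: sum.distrib sum_subtractf smult_sum_right)
  also have "\<dots> = [:0, 1:] * s_plus \<beta> lam m + smult D (s_plus \<beta> lam m) - smult E (s_plus \<beta> lam (m - 1))"
    using s[of m "Suc m"] s[of "m - 1" "Suc m"] by simp
  finally show ?thesis
    unfolding D E by (simp only: distrib_right mult_pCons_left) simp
qed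

theorem proposition2p3:
  fixes \<beta> lam :: complex
  shows "s_plus_int \<beta> lam 0 = 1 \<and>
    (\<forall>m::int. m \<ge> 1 \<longrightarrow>
      s_plus_int \<beta> lam m =
        ([:0, 1:] + [:2 * (of_int m - 1) * (lam + of_int m - 1) + \<beta> / 2 * (lam - \<beta> / 2 + 1):])
          * s_plus_int \<beta> lam (m - 1)
        - smult ((of_int m - 1) * (lam + of_int m - 2) * (lam - \<beta> / 2 + of_int m - 1)
                  * (\<beta> / 2 + of_int m - 2))
            (s_plus_int \<beta> lam (m - 2)))"
proof (intro conjI allI impI)
  show "s_plus_int \<beta> lam 0 = 1"
    by (simp add: s_plus_int_def s_plus_def R0_def one_pCons)
next
  fix m :: int
  assume "m \<ge> 1"
  then obtain n where m: "m = int (Suc n)"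
    by (metis One_nat_def Suc_le_D int_one_le_iff_zero_less nat_0_le of_nat_1 of_nat_le_iff order.trans zero_le_one)
  have cur: "s_plus_int \<beta> lam m = s_plus \<beta> lam (Suc n)"
    and prev: "s_plus_int \<beta> lam (m - 1) = s_plus \<beta> lam n"
    unfolding m s_plus_int_def by (simp_all add: nat_add_distrib)
  \<comment> \<open>At \<open>n = 0\<close> the indices \<open>m - 2 = -1\<close> and \<open>n - 1 = 0\<close> differ, but the scalar vanishes.\<close>
  have prev2: "smult (of_nat n * x) (s_plus_int \<beta> lam (m - 2)) = smult (of_nat n * x) (s_plus \<beta> lam (n - 1))" for x
    unfolding m s_plus_int_def by (cases n) simp_all
  have of_m: "of_int m = (of_nat n + 1 :: complex)"
    by (simp add: m)
  show "s_plus_int \<beta> lam m =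
        ([:0, 1:] + [:2 * (of_int m - 1) * (lam + of_int m - 1) + \<beta> / 2 * (lam - \<beta> / 2 + 1):])
          * s_plus_int \<beta> lam (m - 1)
        - smult ((of_int m - 1) * (lam + of_int m - 2) * (lam - \<beta> / 2 + of_int m - 1)
                  * (\<beta> / 2 + of_int m - 2))
            (s_plus_int \<beta> lam (m - 2))"
  proof -
    have shifts: "(of_nat n + 1 :: complex) - 1 = of_nat n"
      "a + (of_nat n + 1) - 1 = a + of_nat n" "a + (of_nat n + 1) - 2 = a + of_nat n - 1" for a :: complex
      by simp_all
    show ?thesis
      unfolding of_m shifts cur prev mult.assoc prev2
      using s_plus_Suc[of \<beta> lam n] by (simp only: mult.assoc)
  qed
qed

end
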